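(* The following hold for quantitative automata. (1) Every history deterministic $\mathsf{Val}$ automaton (for any value function $\mathsf{Val}$) is threshold history deterministic; the converse does not hold in general: there exist a value function $\mathsf{Val}$ and a $\mathsf{Val}$ automaton that is threshold history deterministic but not history deterministic. (2) Every $\mathsf{Val}$ automaton that is determinizable by pruning is threshold determinizable by pruning; the converse does not hold in general: there exist a value function $\mathsf{Val}$ and a $\mathsf{Val}$ automaton that is threshold determinizable by pruning but not determinizable by pruning. (3) Threshold determinizability by pruning does not imply history determinism: there exist a value function $\mathsf{Val}$ and a $\mathsf{Val}$ automaton that is threshold determinizable by pruning but not history deterministic.
   Context: **Automata.** An alternating quantitative automaton is $\mathcal{A}=(\Sigma,Q,\iota,\delta)$ with finite nonempty alphabet $\Sigma$, finite nonempty state set $Q$, initial state $\iota\in Q$, and $\delta:Q\times\Sigma\to \mathsf{B}^+(\mathbb{Q}\times Q)$, where $\mathsf{B}^+(\mathbb{Q}\times Q)$ is the set of positive Boolean formulas over (rational weight, state) pairs; it is total (each $\delta(q,a)$ contains at least one pair). It is deterministic if every $\delta(q,a)$ is a single pair. A $\mathsf{Val}$ automaton is one equipped with a value function $\mathsf{Val}:\mathbb{Q}^*\to\mathbb{R}$ (finite words) or $\mathsf{Val}:\mathbb{Q}^\omega\to\mathbb{R}$ (infinite words). For a word $w$, the game $G(\mathcal{A},w)$ is played letter by letter from $\iota$: in state $q$ with next letter $a$, Eve resolves the disjunctions and Adam the conjunctions of $\delta(q,a)$ until a pair $(x,q')$ is reached; weight $x$ is output and the state becomes $q'$. The payoff,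 which Eve maximises and Adam minimises, is $\mathsf{Val}$ of the output weight sequence. $\mathcal{A}(w)$ is the value of this game (common value of sup over Eve's strategies of guaranteed payoff and inf over Adam's strategies of guaranteed payoff); only automata for which these agree for all $w$ are considered. Two automata are equivalent, $\mathcal{A}\equiv\mathcal{A}'$, if $\mathcal{A}(w)=\mathcal{A}'(w)$ for all $w$. **Letter games.** Eve's letter game on $\mathcal{A}$: starting from $\iota$, repeatedly, in state $q$ Adam picks a letter $a\in\Sigma$, then Eve resolves the disjunctions and Adam the conjunctions of $\delta(q,a)$, yielding a transition with some weight and a new state. An infinite play yields an infinite word $w$ and an infinite sequence $\pi$ of transitions; $\mathsf{Val}(\pi)$ denotes $\mathsf{Val}$ of its weight sequence. For infinite words, Eve wins the play in the letter game if $\mathsf{Val}(\pi)\ge\mathcal{A}(w)$, and in the $t$-threshold letter game if $\mathcal{A}(w)\ge t\implies\mathsf{Val}(\pi)\ge t$. For finite words, Eve wins if the respective condition holds for all prefixes $w[0..i],\pi[0..i]$. Adam's letter game is the same except that Eve picks the letters; Adam wins the play in the letter game if $\mathsf{Val}(\pi)\le\mathcal{A}(w)$, and in the $t$-threshold letter game if $\mathcal{A}(w)<t\implies\mathsf{Val}(\pi)<t$ (for finite words: for all prefixes). A player wins a letter game if they have a strategy such that all plays agreeing with it are won by them. **History determinism.** $\mathcal{A}$ is history deterministic if Eve and Adam win their respective letter games; $t$-threshold history deterministic if they win their respective $t$-threshold letter games; threshold history deterministic if this holds for all $t\in\mathbb{R}$. **Pruning.** A deterministic automaton is derived from $\mathcal{A}$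 by pruning if it results from removing states and transitions, where in alternating automata removing transitions means removing disjunctive and conjunctive choices (so that each remaining $\delta(q,a)$ becomes one of its pairs). $\mathcal{A}$ is determinizable by pruning if some deterministic $\mathsf{Val}$ automaton $\mathcal{A}'$ derived from it by pruning satisfies $\mathcal{A}'\equiv\mathcal{A}$; $t$-threshold determinizable by pruning if some deterministic $\mathcal{A}'$ derived by pruning satisfies $\mathcal{A}'(w)\ge t\iff\mathcal{A}(w)\ge t$ for every word $w$; threshold determinizable by pruning if it is $t$-threshold determinizable by pruning for all $t\in\mathbb{R}$. *)

theory Defs
  imports "HOL-Library.Extended_Real"
begin

text \<open>
  Positive Boolean formulas. There are no constants for truth and falsity: a formula is resolved
  until a pair is reached, and every formula of this type contains at least one atom, so
  transition functions are total.
\<close>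

datatype 'p pbf =
    Atom 'p
  | Disj "'p pbf" "'p pbf"
  | Conj "'p pbf" "'p pbf"

record ('a, 'q) automaton =
  alphabet :: "'a set"
  states :: "'q set"
  init :: 'q
  trans :: "'q \<Rightarrow> 'a \<Rightarrow> (rat \<times> 'q) pbf"

definition wf_automaton :: "('a, 'q) automaton \<Rightarrow> bool" where
  "wf_automaton A \<longleftrightarrow>
     finite (alphabet A) \<and> alphabet A \<noteq> {} \<and>
     finite (states A) \<and> states A \<noteq> {} \<and> init A \<in> states A \<and>
     (\<forall>q\<in>states A. \<forall>a\<in>alphabet A. snd ` set_pbf (trans A q a) \<subseteq> states A)"

definition deterministic :: "('a, 'q) automaton \<Rightarrow> bool" where
  "deterministic A \<longleftrightarrow> (\<forall>q\<in>states A. \<forall>a\<in>alphabet A. \<exists>x q'. trans A q a = Atom (x, q'))"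

datatype 'x seq = FinSeq "'x list" | InfSeq "nat \<Rightarrow> 'x"

fun prefixes_of :: "'x seq \<Rightarrow> 'x list set" where
  "prefixes_of (FinSeq xs) = {take n xs | n. True}"
| "prefixes_of (InfSeq f) = {map f [0..<n] | n. True}"

text \<open>A value function is either one on finite or one on infinite sequences, and thereby fixes
  whether the automaton reads finite or infinite words.\<close>

datatype value_function = FinVal "rat list \<Rightarrow> real" | InfVal "(nat \<Rightarrow> rat) \<Rightarrow> real"

fun words :: "value_function \<Rightarrow> 'a set \<Rightarrow> 'a seq set" where
  "words (FinVal _) S = {FinSeq w | w. set w \<subseteq> S}"
| "words (InfVal _) S = {InfSeq w | w. range w \<subseteq> S}"

text \<open>The two remaining combinations are left unspecified; they are never used.\<close>

fun apply_val :: "value_function \<Rightarrow> rat seq \<Rightarrow> real" where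
  "apply_val (FinVal f) (FinSeq xs) = f xs"
| "apply_val (InfVal f) (InfSeq xs) = f xs"

text \<open>
  One round of a play: the letter read, the successive choices made (by whichever player owns the
  connective) while resolving the formula, where \<^term>\<open>True\<close> stands for the left argument, and the
  pair that is finally reached.
\<close>

datatype ('a, 'q) round =
  Round (letter: 'a) (choices: "bool list") (weight: rat) (target: 'q)

fun subformula :: "'p pbf \<Rightarrow> bool list \<Rightarrow> 'p pbf option" where
  "subformula \<phi> [] = Some \<phi>"
| "subformula (Atom _) (b # bs) = None"
| "subformula (Disj \<phi> \<psi>) (b # bs) = subformula (if b then \<phi> else \<psi>) bs"
| "subformula (Conj \<phi> \<psi>) (b # bs) = subformula (if b then \<phi> else \<psi>) bs"

definition current_state :: "('a, 'q) automaton \<Rightarrow> ('a, 'q) round list \<Rightarrow> 'q" where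
  "current_state A h = (if h = [] then init A else target (last h))"

definition current_formula ::
    "('a, 'q) automaton \<Rightarrow> ('a, 'q) round list \<Rightarrow> 'a \<Rightarrow> bool list \<Rightarrow> (rat \<times> 'q) pbf option" where
  "current_formula A h a bs = subformula (trans A (current_state A h) a) bs"

definition is_play :: "('a, 'q) automaton \<Rightarrow> ('a, 'q) round seq \<Rightarrow> bool" where
  "is_play A \<rho> \<longleftrightarrow>
     (\<forall>h r. h @ [r] \<in> prefixes_of \<rho> \<longrightarrow>
        letter r \<in> alphabet A \<and>
        current_formula A h (letter r) (choices r) = Some (Atom (weight r, target r)))"

text \<open>
  A strategy sees the completed rounds, the current letter and the choices already made in the
  current round. For both players it is consulted only at the connectives the player owns.
\<close>

type_synonym ('a, 'q) strategy = "('a, 'q) round list \<Rightarrow> 'a \<Rightarrow> bool list \<Rightarrow> bool"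

definition agrees_Eve :: "('a, 'q) automaton \<Rightarrow> ('a, 'q) strategy \<Rightarrow> ('a, 'q) round seq \<Rightarrow> bool" where
  "agrees_Eve A s \<rho> \<longleftrightarrow>
     (\<forall>h r. h @ [r] \<in> prefixes_of \<rho> \<longrightarrow>
        (\<forall>k < length (choices r). \<forall>\<phi> \<psi>.
           current_formula A h (letter r) (take k (choices r)) = Some (Disj \<phi> \<psi>) \<longrightarrow>
           choices r ! k = s h (letter r) (take k (choices r))))"

definition agrees_Adam :: "('a, 'q) automaton \<Rightarrow> ('a, 'q) strategy \<Rightarrow> ('a, 'q) round seq \<Rightarrow> bool" where
  "agrees_Adam A s \<rho> \<longleftrightarrow>
     (\<forall>h r. h @ [r] \<in> prefixes_of \<rho> \<longrightarrow>
        (\<forall>k < length (choices r). \<forall>\<phi> \<psi>.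
           current_formula A h (letter r) (take k (choices r)) = Some (Conj \<phi> \<psi>) \<longrightarrow>
           choices r ! k = s h (letter r) (take k (choices r))))"

definition word_of :: "('a, 'q) round seq \<Rightarrow> 'a seq" where
  "word_of \<rho> = map_seq letter \<rho>"

definition payoff :: "value_function \<Rightarrow> ('a, 'q) round seq \<Rightarrow> real" where
  "payoff V \<rho> = apply_val V (map_seq weight \<rho>)"

text \<open>Values are taken in the extended reals, since an arbitrary value function on infinite
  sequences need not be bounded on the plays over a fixed word.\<close>

definition value_Eve :: "value_function \<Rightarrow> ('a, 'q) automaton \<Rightarrow> 'a seq \<Rightarrow> ereal" where
  "value_Eve V A w =
     (SUP s. INF \<rho>\<in>{\<rho>. is_play A \<rho> \<and> word_of \<rho> = w \<and> agrees_Eve A s \<rho>}. ereal (payoff V \<rho>))"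

definition value_Adam :: "value_function \<Rightarrow> ('a, 'q) automaton \<Rightarrow> 'a seq \<Rightarrow> ereal" where
  "value_Adam V A w =
     (INF s. SUP \<rho>\<in>{\<rho>. is_play A \<rho> \<and> word_of \<rho> = w \<and> agrees_Adam A s \<rho>}. ereal (payoff V \<rho>))"

text \<open>Only automata whose games are determined are considered; for these, \<open>value_of\<close> is the common
  value.\<close>

definition val_automaton :: "value_function \<Rightarrow> ('a, 'q) automaton \<Rightarrow> bool" where
  "val_automaton V A \<longleftrightarrow>
     wf_automaton A \<and> (\<forall>w\<in>words V (alphabet A). value_Eve V A w = value_Adam V A w)"

definition value_of :: "value_function \<Rightarrow> ('a, 'q) automaton \<Rightarrow> 'a seq \<Rightarrow> ereal" where
  "value_of V A w = value_Eve V A w"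

definition real_valued :: "value_function \<Rightarrow> ('a, 'q) automaton \<Rightarrow> bool" where
  "real_valued V A \<longleftrightarrow> (\<forall>w\<in>words V (alphabet A). \<bar>value_of V A w\<bar> \<noteq> \<infinity>)"

definition equivalent ::
    "value_function \<Rightarrow> ('a, 'q) automaton \<Rightarrow> ('a, 'q) automaton \<Rightarrow> bool" where
  "equivalent V A B \<longleftrightarrow>
     alphabet A = alphabet B \<and> (\<forall>w\<in>words V (alphabet A). value_of V A w = value_of V B w)"

text \<open>
  The parts of an infinite play of a letter game on which the winning condition is checked: all
  nonempty finite prefixes for automata on finite words, the play itself otherwise.
\<close>

fun judged :: "value_function \<Rightarrow> (nat \<Rightarrow> 'x) \<Rightarrow> 'x seq set" where
  "judged (FinVal _) \<rho> = {FinSeq (map \<rho> [0..<Suc i]) | i. True}"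
| "judged (InfVal _) \<rho> = {InfSeq \<rho>}"

definition Eve_wins_letter_game :: "value_function \<Rightarrow> ('a, 'q) automaton \<Rightarrow> bool" where
  "Eve_wins_letter_game V A \<longleftrightarrow>
     (\<exists>s. \<forall>\<rho>. is_play A (InfSeq \<rho>) \<and> agrees_Eve A s (InfSeq \<rho>) \<longrightarrow>
        (\<forall>\<pi>\<in>judged V \<rho>. ereal (payoff V \<pi>) \<ge> value_of V A (word_of \<pi>)))"

definition Adam_wins_letter_game :: "value_function \<Rightarrow> ('a, 'q) automaton \<Rightarrow> bool" where
  "Adam_wins_letter_game V A \<longleftrightarrow>
     (\<exists>s. \<forall>\<rho>. is_play A (InfSeq \<rho>) \<and> agrees_Adam A s (InfSeq \<rho>) \<longrightarrow>
        (\<forall>\<pi>\<in>judged V \<rho>. ereal (payoff V \<pi>) \<le> value_of V A (word_of \<pi>)))"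

definition Eve_wins_threshold_letter_game ::
    "value_function \<Rightarrow> real \<Rightarrow> ('a, 'q) automaton \<Rightarrow> bool" where
  "Eve_wins_threshold_letter_game V t A \<longleftrightarrow>
     (\<exists>s. \<forall>\<rho>. is_play A (InfSeq \<rho>) \<and> agrees_Eve A s (InfSeq \<rho>) \<longrightarrow>
        (\<forall>\<pi>\<in>judged V \<rho>. value_of V A (word_of \<pi>) \<ge> ereal t \<longrightarrow> payoff V \<pi> \<ge> t))"

definition Adam_wins_threshold_letter_game ::
    "value_function \<Rightarrow> real \<Rightarrow> ('a, 'q) automaton \<Rightarrow> bool" where
  "Adam_wins_threshold_letter_game V t A \<longleftrightarrow>
     (\<exists>s. \<forall>\<rho>. is_play A (InfSeq \<rho>) \<and> agrees_Adam A s (InfSeq \<rho>) \<longrightarrow>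
        (\<forall>\<pi>\<in>judged V \<rho>. value_of V A (word_of \<pi>) < ereal t \<longrightarrow> payoff V \<pi> < t))"

definition history_deterministic :: "value_function \<Rightarrow> ('a, 'q) automaton \<Rightarrow> bool" where
  "history_deterministic V A \<longleftrightarrow> Eve_wins_letter_game V A \<and> Adam_wins_letter_game V A"

definition t_threshold_history_deterministic ::
    "value_function \<Rightarrow> real \<Rightarrow> ('a, 'q) automaton \<Rightarrow> bool" where
  "t_threshold_history_deterministic V t A \<longleftrightarrow>
     Eve_wins_threshold_letter_game V t A \<and> Adam_wins_threshold_letter_game V t A"

definition threshold_history_deterministic ::
    "value_function \<Rightarrow> ('a, 'q) automaton \<Rightarrow> bool" where
  "threshold_history_deterministic V A \<longleftrightarrow> (\<forall>t. t_threshold_history_deterministic V t A)"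

text \<open>\<open>pruned \<phi> \<phi>'\<close>: \<open>\<phi>'\<close> results from \<open>\<phi>\<close> by removing disjunctive and conjunctive choices.\<close>

inductive pruned :: "'p pbf \<Rightarrow> 'p pbf \<Rightarrow> bool" where
  "pruned (Atom x) (Atom x)"
| "pruned \<phi> \<phi>' \<Longrightarrow> pruned \<psi> \<psi>' \<Longrightarrow> pruned (Disj \<phi> \<psi>) (Disj \<phi>' \<psi>')"
| "pruned \<phi> \<phi>' \<Longrightarrow> pruned (Disj \<phi> \<psi>) \<phi>'"
| "pruned \<psi> \<psi>' \<Longrightarrow> pruned (Disj \<phi> \<psi>) \<psi>'"
| "pruned \<phi> \<phi>' \<Longrightarrow> pruned \<psi> \<psi>' \<Longrightarrow> pruned (Conj \<phi> \<psi>) (Conj \<phi>' \<psi>')"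
| "pruned \<phi> \<phi>' \<Longrightarrow> pruned (Conj \<phi> \<psi>) \<phi>'"
| "pruned \<psi> \<psi>' \<Longrightarrow> pruned (Conj \<phi> \<psi>) \<psi>'"

definition derived_by_pruning :: "('a, 'q) automaton \<Rightarrow> ('a, 'q) automaton \<Rightarrow> bool" where
  "derived_by_pruning A A' \<longleftrightarrow>
     alphabet A' = alphabet A \<and> states A' \<subseteq> states A \<and> init A' = init A \<and>
     (\<forall>q\<in>states A'. \<forall>a\<in>alphabet A. pruned (trans A q a) (trans A' q a))"

definition determinizable_by_pruning :: "value_function \<Rightarrow> ('a, 'q) automaton \<Rightarrow> bool" where
  "determinizable_by_pruning V A \<longleftrightarrow>
     (\<exists>A'. val_automaton V A' \<and> deterministic A' \<and> derived_by_pruning A A' \<and> equivalent V A' A)"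

definition t_threshold_determinizable_by_pruning ::
    "value_function \<Rightarrow> real \<Rightarrow> ('a, 'q) automaton \<Rightarrow> bool" where
  "t_threshold_determinizable_by_pruning V t A \<longleftrightarrow>
     (\<exists>A'. val_automaton V A' \<and> deterministic A' \<and> derived_by_pruning A A' \<and>
        (\<forall>w\<in>words V (alphabet A). value_of V A' w \<ge> ereal t \<longleftrightarrow> value_of V A w \<ge> ereal t))"

definition threshold_determinizable_by_pruning ::
    "value_function \<Rightarrow> ('a, 'q) automaton \<Rightarrow> bool" where
  "threshold_determinizable_by_pruning V A \<longleftrightarrow>
     (\<forall>t. t_threshold_determinizable_by_pruning V t A)"

end

theory Submission
  imports Defs
begin

text \<open>
  Only the separations need an idea. Take a single state in which Eve resolves each letter to a
  weight of absolute value 1 or 2, the letter fixing the sign, and let the payoff be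
  \<open>\<bar>x\<bar> * sgn y\<close> for the first two weights \<open>x\<close> and \<open>y\<close>. Seen from the whole word, the optimal first
  choice is 2 if the second letter is positive (value 2) and 1 if it is negative (value -1), but
  in the letter game, or after pruning, the choice has to be made before the second letter is
  known. For a fixed threshold \<open>t\<close> this does not matter: always choosing 1 is good enough if
  \<open>t \<le> -1\<close>, and always choosing 2 if \<open>t > -1\<close>.
\<close>

section \<open>Plays and values\<close>

text \<open>Turns the quantification over prefixes \<open>h @ [r]\<close> in \<open>is_play\<close>
  and in the agreement predicates into one over round numbers.\<close>

lemma snoc_in_prefixes_InfSeq:
  "h @ [r] \<in> prefixes_of (InfSeq f) \<longleftrightarrow> (\<exists>n. h = map f [0..<n] \<and> r = f n)"
proof
  assume "h @ [r] \<in> prefixes_of (InfSeq f)"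
  then obtain n where n: "h @ [r] = map f [0..<n]" by auto
  then obtain m where "n = Suc m" by (cases n) auto
  with n show "\<exists>n. h = map f [0..<n] \<and> r = f n" by auto
next
  assume "\<exists>n. h = map f [0..<n] \<and> r = f n"
  then obtain n where "h @ [r] = map f [0..<Suc n]" by auto
  then show "h @ [r] \<in> prefixes_of (InfSeq f)" by (metis (mono_tags, lifting) CollectI prefixes_of.simps(2))
qed

lemma prefixes_of_FinSeq_map_upt:
  "prefixes_of (FinSeq (map f [0..<n])) \<subseteq> prefixes_of (InfSeq f)"
  by (auto simp: take_map) (metis add_0 diff_zero length_upt linorder_le_cases take_all take_upt)

text \<open>All conditions on plays quantify over prefixes, so this inclusion carries legality and
  agreement from an infinite play to its judged parts.\<close>

lemma prefixes_of_judged: "\<pi> \<in> judged V \<rho> \<Longrightarrow> prefixes_of \<pi> \<subseteq> prefixes_of (InfSeq \<rho>)"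
  using prefixes_of_FinSeq_map_upt[of \<rho>] by (cases V) (auto simp del: prefixes_of.simps upt_Suc)

lemma is_play_mono: "is_play A \<rho> \<Longrightarrow> prefixes_of \<pi> \<subseteq> prefixes_of \<rho> \<Longrightarrow> is_play A \<pi>"
  unfolding is_play_def by blast

lemma agrees_Eve_mono:
  "agrees_Eve A s \<rho> \<Longrightarrow> prefixes_of \<pi> \<subseteq> prefixes_of \<rho> \<Longrightarrow> agrees_Eve A s \<pi>"
  unfolding agrees_Eve_def by blast

lemma agrees_Adam_mono:
  "agrees_Adam A s \<rho> \<Longrightarrow> prefixes_of \<pi> \<subseteq> prefixes_of \<rho> \<Longrightarrow> agrees_Adam A s \<pi>"
  unfolding agrees_Adam_def by blast

section \<open>Existence of plays that follow given strategies\<close>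

text \<open>Walk down the formula, asking \<open>f\<close> at disjunctions and \<open>g\<close> at
  conjunctions; the walk ends in an atom because formulas are finite and have no constants. Both
  functions are generalised in the induction, since below the root they are consulted with the root
  choice prepended.\<close>

lemma ex_resolution:
  "\<exists>bs p. subformula \<phi> bs = Some (Atom p) \<and>
     (\<forall>k<length bs. \<forall>\<alpha> \<beta>. subformula \<phi> (take k bs) = Some (Disj \<alpha> \<beta>) \<longrightarrow> bs ! k = f (take k bs)) \<and>
     (\<forall>k<length bs. \<forall>\<alpha> \<beta>. subformula \<phi> (take k bs) = Some (Conj \<alpha> \<beta>) \<longrightarrow> bs ! k = g (take k bs))"
proof (induction \<phi> arbitrary: f g)
  case (Atom x)
  show ?case by (rule exI[of _ "[]"]) simp
next
  case (Disj \<phi>1 \<phi>2)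
  let ?b = "f []"
  obtain bs p where
    "subformula (if ?b then \<phi>1 else \<phi>2) bs = Some (Atom p)"
    "\<And>k \<alpha> \<beta>. k < length bs \<Longrightarrow> subformula (if ?b then \<phi>1 else \<phi>2) (take k bs) = Some (Disj \<alpha> \<beta>)
       \<Longrightarrow> bs ! k = f (?b # take k bs)"
    "\<And>k \<alpha> \<beta>. k < length bs \<Longrightarrow> subformula (if ?b then \<phi>1 else \<phi>2) (take k bs) = Some (Conj \<alpha> \<beta>)
       \<Longrightarrow> bs ! k = g (?b # take k bs)"
    using Disj.IH(1)[of "\<lambda>bs. f (?b # bs)" "\<lambda>bs. g (?b # bs)"]
      Disj.IH(2)[of "\<lambda>bs. f (?b # bs)" "\<lambda>bs. g (?b # bs)"]
    by (cases ?b) auto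
  then show ?case
    by (intro exI[of _ "?b # bs"] exI[of _ p])
      (auto simp: less_Suc_eq_0_disj)
next
  case (Conj \<phi>1 \<phi>2)
  let ?b = "g []"
  obtain bs p where
    "subformula (if ?b then \<phi>1 else \<phi>2) bs = Some (Atom p)"
    "\<And>k \<alpha> \<beta>. k < length bs \<Longrightarrow> subformula (if ?b then \<phi>1 else \<phi>2) (take k bs) = Some (Disj \<alpha> \<beta>)
       \<Longrightarrow> bs ! k = f (?b # take k bs)"
    "\<And>k \<alpha> \<beta>. k < length bs \<Longrightarrow> subformula (if ?b then \<phi>1 else \<phi>2) (take k bs) = Some (Conj \<alpha> \<beta>)
       \<Longrightarrow> bs ! k = g (?b # take k bs)"
    using Conj.IH(1)[of "\<lambda>bs. f (?b # bs)" "\<lambda>bs. g (?b # bs)"]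
      Conj.IH(2)[of "\<lambda>bs. f (?b # bs)" "\<lambda>bs. g (?b # bs)"]
    by (cases ?b) auto
  then show ?case
    by (intro exI[of _ "?b # bs"] exI[of _ p])
      (auto simp: less_Suc_eq_0_disj)
qed

text \<open>With both strategies and all letters fixed, each round is obtained from the history by
  resolving one formula.\<close>

lemma ex_infinite_play:
  assumes "range u \<subseteq> alphabet A"
  shows "\<exists>\<rho>. (\<forall>n. letter (\<rho> n) = u n) \<and> is_play A (InfSeq \<rho>) \<and>
           agrees_Eve A s (InfSeq \<rho>) \<and> agrees_Adam A s' (InfSeq \<rho>)"
proof -
  define ok where "ok h a r \<longleftrightarrow> letter r = a \<and>
      current_formula A h a (choices r) = Some (Atom (weight r, target r)) \<and>
      (\<forall>k<length (choices r). \<forall>\<alpha> \<beta>. current_formula A h a (take k (choices r)) = Some (Disj \<alpha> \<beta>)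
         \<longrightarrow> choices r ! k = s h a (take k (choices r))) \<and>
      (\<forall>k<length (choices r). \<forall>\<alpha> \<beta>. current_formula A h a (take k (choices r)) = Some (Conj \<alpha> \<beta>)
         \<longrightarrow> choices r ! k = s' h a (take k (choices r)))" for h a r
  have "\<exists>r. ok h a r" for h a
  proof -
    obtain bs x q where
      "subformula (trans A (current_state A h) a) bs = Some (Atom (x, q))"
      "\<forall>k<length bs. \<forall>\<alpha> \<beta>. subformula (trans A (current_state A h) a) (take k bs) = Some (Disj \<alpha> \<beta>)
         \<longrightarrow> bs ! k = s h a (take k bs)"
      "\<forall>k<length bs. \<forall>\<alpha> \<beta>. subformula (trans A (current_state A h) a) (take k bs) = Some (Conj \<alpha> \<beta>)
         \<longrightarrow> bs ! k = s' h a (take k bs)"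
      using ex_resolution[of "trans A (current_state A h) a" "s h a" "s' h a"] by auto
    then have "ok h a (Round a bs x q)"
      by (simp add: ok_def current_formula_def)
    then show ?thesis ..
  qed
  then obtain R where R: "ok h a (R h a)" for h a by metis
  \<comment> \<open>The recursion carries the whole history because strategies depend on it; the
    play is read off from it afterwards.\<close>
  define H where "H = rec_nat [] (\<lambda>n h. h @ [R h (u n)])"
  define \<rho> where "\<rho> n = R (H n) (u n)" for n
  have H: "H n = map \<rho> [0..<n]" for n
    by (induction n) (simp_all add: H_def \<rho>_def)
  have ok: "ok (map \<rho> [0..<n]) (u n) (\<rho> n)" for n
    using R[of "H n" "u n"] by (simp flip: \<rho>_def H)
  then have l: "letter (\<rho> n) = u n" for n
    by (simp add: ok_def)
  have "is_play A (InfSeq \<rho>)" "agrees_Eve A s (InfSeq \<rho>)" "agrees_Adam A s' (InfSeq \<rho>)"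
    using ok l assms
    unfolding is_play_def agrees_Eve_def agrees_Adam_def snoc_in_prefixes_InfSeq ok_def by auto
  with l show ?thesis by blast
qed

lemma ex_play:
  assumes "w \<in> words V (alphabet A)" "alphabet A \<noteq> {}"
  shows "\<exists>\<rho>. word_of \<rho> = w \<and> is_play A \<rho> \<and> agrees_Eve A s \<rho> \<and> agrees_Adam A s' \<rho>"
proof (cases w)
  case (FinSeq xs)
  from assms obtain a where a: "a \<in> alphabet A" by blast
  have "set xs \<subseteq> alphabet A" using assms FinSeq by (cases V) auto
  \<comment> \<open>A finite word is padded with an arbitrary letter to an infinite one, and the
    resulting play is cut back to the length of the word.\<close>
  with a have "range (\<lambda>n. if n < length xs then xs ! n else a) \<subseteq> alphabet A"
    by (auto dest: nth_mem)
  from ex_infinite_play[OF this] obtain \<rho> where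
    \<rho>: "\<And>n. letter (\<rho> n) = (if n < length xs then xs ! n else a)"
      "is_play A (InfSeq \<rho>)" "agrees_Eve A s (InfSeq \<rho>)" "agrees_Adam A s' (InfSeq \<rho>)" by metis
  have "word_of (FinSeq (map \<rho> [0..<length xs])) = w"
    by (auto simp: word_of_def FinSeq \<rho>(1) intro: nth_equalityI)
  then show ?thesis
    using \<rho>(2-) prefixes_of_FinSeq_map_upt[of \<rho> "length xs"]
    by (blast intro: is_play_mono agrees_Eve_mono agrees_Adam_mono)
next
  case (InfSeq u)
  have "range u \<subseteq> alphabet A" using assms InfSeq by (cases V) auto
  from ex_infinite_play[OF this] obtain \<rho> where
    "\<And>n. letter (\<rho> n) = u n"
    "is_play A (InfSeq \<rho>)" "agrees_Eve A s (InfSeq \<rho>)" "agrees_Adam A s' (InfSeq \<rho>)" by metis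
  then show ?thesis
    by (intro exI[of _ "InfSeq \<rho>"]) (auto simp: word_of_def InfSeq)
qed

section \<open>Values of games over a fixed word\<close>

text \<open>Any two opposing strategies share a play over \<open>w\<close>, whose payoff lies above
  the infimum for Eve's strategy and below the supremum for Adam's.\<close>

lemma value_Eve_le_value_Adam:
  assumes "w \<in> words V (alphabet A)" "alphabet A \<noteq> {}"
  shows "value_Eve V A w \<le> value_Adam V A w"
  unfolding value_Eve_def value_Adam_def
proof (intro SUP_least INF_greatest)
  fix s s'
  obtain \<rho> where "word_of \<rho> = w" "is_play A \<rho>" "agrees_Eve A s \<rho>" "agrees_Adam A s' \<rho>"
    using ex_play[OF assms] by blast
  then show "(INF \<rho>\<in>{\<rho>. is_play A \<rho> \<and> word_of \<rho> = w \<and> agrees_Eve A s \<rho>}. ereal (payoff V \<rho>))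
      \<le> (SUP \<rho>\<in>{\<rho>. is_play A \<rho> \<and> word_of \<rho> = w \<and> agrees_Adam A s' \<rho>}. ereal (payoff V \<rho>))"
    by (intro INF_lower2[of \<rho>] SUP_upper2[of \<rho>]) auto
qed

text \<open>Strategies guaranteeing the same \<open>m\<close> to both players squeeze both values to
  \<open>m\<close>, which yields determinacy along with the value.\<close>

lemma value_eqI:
  assumes "w \<in> words V (alphabet A)" "alphabet A \<noteq> {}"
    and "\<And>\<rho>. is_play A \<rho> \<Longrightarrow> word_of \<rho> = w \<Longrightarrow> agrees_Eve A s \<rho> \<Longrightarrow> m \<le> payoff V \<rho>"
    and "\<And>\<rho>. is_play A \<rho> \<Longrightarrow> word_of \<rho> = w \<Longrightarrow> agrees_Adam A s' \<rho> \<Longrightarrow> payoff V \<rho> \<le> m"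
  shows "value_Eve V A w = ereal m" "value_Adam V A w = ereal m"
proof -
  have "ereal m \<le> value_Eve V A w"
    unfolding value_Eve_def by (rule SUP_upper2[of s]) (auto intro!: INF_greatest assms(3))
  moreover have "value_Adam V A w \<le> ereal m"
    unfolding value_Adam_def by (rule INF_lower2[of s']) (auto intro!: SUP_least assms(4))
  ultimately show "value_Eve V A w = ereal m" "value_Adam V A w = ereal m"
    using value_Eve_le_value_Adam[OF assms(1,2)] by auto
qed

text \<open>Resolving and pruning only discard atoms, so a bound on the atoms of a formula controls
  plays of the automaton and of its prunings alike.\<close>

lemma set_pbf_subformula: "subformula \<phi> bs = Some \<psi> \<Longrightarrow> set_pbf \<psi> \<subseteq> set_pbf \<phi>"
  by (induction \<phi> bs rule: subformula.induct) (auto split: if_splits)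

lemma set_pbf_pruned: "pruned \<phi> \<psi> \<Longrightarrow> set_pbf \<psi> \<subseteq> set_pbf \<phi>"
  by (induction rule: pruned.induct) auto

lemma play_round:
  assumes "is_play A \<rho>" "h @ [r] \<in> prefixes_of \<rho>"
  shows "letter r \<in> alphabet A"
    and "(weight r, target r) \<in> set_pbf (trans A (current_state A h) (letter r))"
  using assms set_pbf_subformula[of "trans A (current_state A h) (letter r)" "choices r"]
  by (auto simp: is_play_def current_formula_def)

section \<open>From values to thresholds\<close>

text \<open>One strategy serves every threshold, by transitivity through the value of the word;
  Adam's case below is dual.\<close>

lemma Eve_wins_letter_game_imp_threshold:
  assumes "Eve_wins_letter_game V A"
  shows "Eve_wins_threshold_letter_game V t A"
proof -
  obtain s where "\<And>\<rho> \<pi>. is_play A (InfSeq \<rho>) \<Longrightarrow> agrees_Eve A s (InfSeq \<rho>) \<Longrightarrow> \<pi> \<in> judged V \<rho>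
      \<Longrightarrow> value_of V A (word_of \<pi>) \<le> ereal (payoff V \<pi>)"
    using assms unfolding Eve_wins_letter_game_def by blast
  then show ?thesis
    unfolding Eve_wins_threshold_letter_game_def
    by (intro exI[of _ s]) (meson ereal_less_eq(3) order_trans)
qed

lemma Adam_wins_letter_game_imp_threshold:
  assumes "Adam_wins_letter_game V A"
  shows "Adam_wins_threshold_letter_game V t A"
proof -
  obtain s where "\<And>\<rho> \<pi>. is_play A (InfSeq \<rho>) \<Longrightarrow> agrees_Adam A s (InfSeq \<rho>) \<Longrightarrow> \<pi> \<in> judged V \<rho>
      \<Longrightarrow> ereal (payoff V \<pi>) \<le> value_of V A (word_of \<pi>)"
    using assms unfolding Adam_wins_letter_game_def by blast
  then show ?thesis
    unfolding Adam_wins_threshold_letter_game_def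
    by (intro exI[of _ s]) (meson less_ereal.simps(1) order_le_less_trans)
qed

lemma history_deterministic_imp_threshold:
  "history_deterministic V A \<Longrightarrow> threshold_history_deterministic V A"
  by (simp add: history_deterministic_def threshold_history_deterministic_def
      t_threshold_history_deterministic_def Eve_wins_letter_game_imp_threshold
      Adam_wins_letter_game_imp_threshold)

text \<open>The same pruned automaton serves every \<open>t\<close>, because equal values lie on the
  same side of each threshold.\<close>

lemma determinizable_by_pruning_imp_threshold:
  "determinizable_by_pruning V A \<Longrightarrow> threshold_determinizable_by_pruning V A"
  unfolding determinizable_by_pruning_def threshold_determinizable_by_pruning_def
    t_threshold_determinizable_by_pruning_def equivalent_def
  by metis

section \<open>The separating automaton\<close>

fun first_two :: "'x seq \<Rightarrow> ('x \<times> 'x) option" where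
  "first_two (FinSeq (x # y # _)) = Some (x, y)"
| "first_two (FinSeq _) = None"
| "first_two (InfSeq f) = Some (f 0, f 1)"

lemma first_two_map_seq: "first_two (map_seq f \<rho>) = map_option (map_prod f f) (first_two \<rho>)"
  by (cases \<rho> rule: first_two.cases) auto

lemma first_two_prefixes:
  assumes "first_two \<rho> = Some (x, y)"
  shows "[] @ [x] \<in> prefixes_of \<rho>" "[x] @ [y] \<in> prefixes_of \<rho>"
proof -
  show "[] @ [x] \<in> prefixes_of \<rho>"
    using assms by (cases \<rho> rule: first_two.cases) (auto intro: exI[of _ "Suc 0"])
  show "[x] @ [y] \<in> prefixes_of \<rho>"
    using assms
    by (cases \<rho> rule: first_two.cases) (auto intro: exI[of _ "Suc (Suc 0)"])
qed

text \<open>The default 0 for fewer than two entries is matched in \<open>best\<close>, so such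
  short prefixes are won by either player.\<close>

definition score :: "rat seq \<Rightarrow> real" where
  "score \<rho> = (case first_two \<rho> of None \<Rightarrow> 0 | Some (x, y) \<Rightarrow> of_rat (\<bar>x\<bar> * sgn y))"

definition score_functions :: "value_function set" where
  "score_functions = {FinVal (score \<circ> FinSeq), InfVal (score \<circ> InfSeq)}"

text \<open>Letter 0 is the positive sign and letter 1 the negative one. There are no conjunctions,
  so all choices are Eve's; \<open>True\<close> selects absolute value 1.\<close>

definition late_sign :: "(nat, nat) automaton" where
  "late_sign = \<lparr>alphabet = {0, 1}, states = {0}, init = 0,
     trans = \<lambda>q a. Disj (Atom ((-1) ^ a, 0)) (Atom (2 * (-1) ^ a, 0))\<rparr>"

definition constant_choice :: "rat \<Rightarrow> (nat, nat) automaton" where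
  "constant_choice c = \<lparr>alphabet = {0, 1}, states = {0}, init = 0,
     trans = \<lambda>q a. Atom (c * (-1) ^ a, 0)\<rparr>"

text \<open>The value of \<open>late_sign\<close>: 2 is the maximum of 1 and 2, and -1 the maximum
  of -1 and -2, the first choice being made with the second letter known.\<close>

definition best :: "nat seq \<Rightarrow> real" where
  "best w = (case first_two w of None \<Rightarrow> 0 | Some (_, b) \<Rightarrow> if b = 0 then 2 else - 1)"

text \<open>Covers \<open>late_sign\<close>, both constant choices and every well-formed pruning at
  once, so that payoffs are computed only once.\<close>

definition refines_late_sign :: "(nat, nat) automaton \<Rightarrow> bool" where
  "refines_late_sign A \<longleftrightarrow> alphabet A = {0, 1} \<and> init A = 0 \<and>
     (\<forall>a\<in>{0, 1}. set_pbf (trans A 0 a) \<subseteq> {((-1) ^ a, 0), (2 * (-1) ^ a, 0)})"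

lemma refines_late_sign_self: "refines_late_sign late_sign"
  by (auto simp: refines_late_sign_def late_sign_def)

lemma refines_late_sign_constant_choice: "c \<in> {1, 2} \<Longrightarrow> refines_late_sign (constant_choice c)"
  by (auto simp: refines_late_sign_def constant_choice_def)

lemma refines_late_sign_pruned:
  assumes "derived_by_pruning late_sign A" "wf_automaton A"
  shows "refines_late_sign A"
  using assms set_pbf_pruned[of "trans late_sign 0 0" "trans A 0 0"]
    set_pbf_pruned[of "trans late_sign 0 1" "trans A 0 1"]
  by (auto simp: refines_late_sign_def derived_by_pruning_def wf_automaton_def late_sign_def)

lemma wf_late_sign: "wf_automaton late_sign"
  by (auto simp: wf_automaton_def late_sign_def)

section \<open>Payoffs of plays\<close>

text \<open>Membership in \<open>words V S\<close> matches the kind of sequence with the kind of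
  value function, which excludes the unspecified cases of \<open>apply_val\<close>; hence
  \<open>S\<close> is arbitrary.\<close>

lemma payoff_eq_score:
  "V \<in> score_functions \<Longrightarrow> word_of \<rho> \<in> words V S \<Longrightarrow> payoff V \<rho> = score (map_seq weight \<rho>)"
  by (cases \<rho>) (auto simp: score_functions_def payoff_def word_of_def)

lemma word_of_judged: "\<pi> \<in> judged V \<rho> \<Longrightarrow> word_of \<pi> \<in> words V UNIV"
  by (cases V) (auto simp: word_of_def)

lemma payoff_refinement:
  assumes "refines_late_sign A" "V \<in> score_functions" "is_play A \<rho>" "word_of \<rho> \<in> words V S"
  shows "payoff V \<rho> = (case first_two \<rho> of None \<Rightarrow> 0
           | Some (r, r') \<Rightarrow> of_rat \<bar>weight r\<bar> * (if letter r' = 0 then 1 else - 1))"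
    and "first_two \<rho> = Some (r, r') \<Longrightarrow> \<bar>weight r\<bar> \<in> {1, 2}"
    and "first_two \<rho> = Some (r, r') \<Longrightarrow> (weight r, target r) \<in> set_pbf (trans A 0 (letter r))"
proof -
  \<comment> \<open>Both rounds start in state 0: the first because it is initial, the second
    because every atom leads back to it.\<close>
  have *: "letter r \<in> {0, 1} \<and> weight r \<in> {(-1) ^ letter r, 2 * (-1) ^ letter r} \<and>
      letter r' \<in> {0, 1} \<and> weight r' \<in> {(-1) ^ letter r', 2 * (-1) ^ letter r'} \<and>
      (weight r, target r) \<in> set_pbf (trans A 0 (letter r))"
    if "first_two \<rho> = Some (r, r')" for r r'
  proof -
    note r = play_round[OF assms(3) first_two_prefixes(1)[OF that]]
    note r' = play_round[OF assms(3) first_two_prefixes(2)[OF that]]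
    have l: "letter r \<in> {0, 1}" "letter r' \<in> {0, 1}" "current_state A [] = 0"
      using r(1) r'(1) assms(1) by (auto simp: refines_late_sign_def current_state_def)
    then have w: "(weight r, target r) \<in> {((-1) ^ letter r, 0), (2 * (-1) ^ letter r, 0)}"
      using r(2) assms(1) unfolding refines_late_sign_def by (metis subsetD)
    then have "current_state A [r] = 0" by (auto simp: current_state_def)
    then have "(weight r', target r') \<in> {((-1) ^ letter r', 0), (2 * (-1) ^ letter r', 0)}"
      using r'(2) l assms(1) unfolding refines_late_sign_def by (metis subsetD)
    with l w r(2) show ?thesis by auto
  qed
  show "payoff V \<rho> = (case first_two \<rho> of None \<Rightarrow> 0
      | Some (r, r') \<Rightarrow> of_rat \<bar>weight r\<bar> * (if letter r' = 0 then 1 else - 1))"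
    unfolding payoff_eq_score[OF assms(2,4)] score_def first_two_map_seq
    by (auto split: option.split dest!: *)
  show "first_two \<rho> = Some (r, r') \<Longrightarrow> \<bar>weight r\<bar> \<in> {1, 2}"
    by (auto dest!: *)
  show "first_two \<rho> = Some (r, r') \<Longrightarrow> (weight r, target r) \<in> set_pbf (trans A 0 (letter r))"
    by (auto dest!: *)
qed

lemma best_word_of:
  "best (word_of \<rho>) =
     (case first_two \<rho> of None \<Rightarrow> 0 | Some (_, r') \<Rightarrow> if letter r' = 0 then 2 else - 1)"
  by (auto simp: best_def word_of_def first_two_map_seq split: option.split)

text \<open>The bound comes from the two possible first absolute values alone. It holds on every
  play, so any strategy of Adam is optimal.\<close>

lemma payoff_le_best:
  assumes "refines_late_sign A" "V \<in> score_functions" "is_play A \<rho>" "word_of \<rho> \<in> words V S"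
  shows "payoff V \<rho> \<le> best (word_of \<rho>)"
  unfolding payoff_refinement(1)[OF assms] best_word_of
  using payoff_refinement(2)[OF assms] by (fastforce split: option.split)

text \<open>The choice list has exactly one entry, as the root is a disjunction of two atoms, and
  this entry is the answer of \<open>s\<close> to the empty list of choices.\<close>

lemma late_sign_weight:
  assumes "is_play late_sign \<rho>" "agrees_Eve late_sign s \<rho>" "h @ [r] \<in> prefixes_of \<rho>"
  shows "\<bar>weight r\<bar> = (if s h (letter r) [] then 1 else 2)"
proof -
  have f: "current_formula late_sign h (letter r) (choices r) = Some (Atom (weight r, target r))"
    using assms unfolding is_play_def by blast
  then obtain b bs where b: "choices r = b # bs"
    by (cases "choices r") (auto simp: current_formula_def late_sign_def)
  then have "b = s h (letter r) []"
    using assms(2,3) unfolding agrees_Eve_def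
    by (force simp: current_formula_def late_sign_def)
  with f b have "weight r = (if s h (letter r) [] then 1 else 2) * (-1) ^ letter r"
    by (cases bs) (auto simp: current_formula_def late_sign_def split: if_splits)
  then show ?thesis by (simp add: abs_mult power_abs)
qed

text \<open>Eve's strategy enters the payoff only through its answer to the first letter, given
  before the second letter is read.\<close>

lemma payoff_late_sign:
  assumes "V \<in> score_functions" "is_play late_sign \<rho>" "word_of \<rho> \<in> words V S"
    and "agrees_Eve late_sign s \<rho>"
  shows "payoff V \<rho> = (case first_two \<rho> of None \<Rightarrow> 0
           | Some (r, r') \<Rightarrow> (if s [] (letter r) [] then 1 else 2) * (if letter r' = 0 then 1 else - 1))"
  unfolding payoff_refinement(1)[OF refines_late_sign_self assms(1-3)]
  by (auto split: option.split
      dest!: first_two_prefixes(1) late_sign_weight[OF assms(2,4)])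

section \<open>Values of the separating automaton and its prunings\<close>

lemma value_late_sign:
  assumes "V \<in> score_functions" "w \<in> words V {0, 1}"
  shows "value_Eve V late_sign w = ereal (best w)" "value_Adam V late_sign w = ereal (best w)"
proof -
  \<comment> \<open>For a fixed word the strategy may depend on the second letter: it takes absolute
    value 1 exactly when that letter is negative.\<close>
  let ?s = "\<lambda>_ _ _. best w = - 1"
  have w: "w \<in> words V (alphabet late_sign)" "alphabet late_sign \<noteq> {}"
    using assms by (auto simp: late_sign_def)
  have "best w \<le> payoff V \<rho>"
    if "is_play late_sign \<rho>" "word_of \<rho> = w" "agrees_Eve late_sign ?s \<rho>" for \<rho>
    using payoff_late_sign[OF assms(1) that(1) _ that(3), of "{0, 1}"] that(2) assms(2)
      best_word_of[of \<rho>]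
    by (auto split: option.splits if_splits)
  moreover have "payoff V \<rho> \<le> best w" if "is_play late_sign \<rho>" "word_of \<rho> = w" for \<rho>
    using payoff_le_best[OF refines_late_sign_self assms(1) that(1)] that(2) assms(2) by blast
  ultimately show "value_Eve V late_sign w = ereal (best w)" "value_Adam V late_sign w = ereal (best w)"
    using value_eqI[OF w, of ?s "best w"] by blast+
qed

lemma val_automaton_late_sign: "V \<in> score_functions \<Longrightarrow> val_automaton V late_sign"
  using wf_late_sign value_late_sign by (auto simp: val_automaton_def late_sign_def)

lemma real_valued_late_sign: "V \<in> score_functions \<Longrightarrow> real_valued V late_sign"
  using value_late_sign(1) by (auto simp: real_valued_def value_of_def late_sign_def)

text \<open>All plays over \<open>w\<close> have the same payoff. Only the formula at the first
  letter of \<open>w\<close> has to be an atom: later weights matter at most by their sign, which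
  the letter fixes.\<close>

lemma value_fixed_first_weight:
  assumes "refines_late_sign A" "V \<in> score_functions" "w \<in> words V {0, 1}"
    and c: "\<And>a b. first_two w = Some (a, b) \<Longrightarrow> \<exists>x q. trans A 0 a = Atom (x, q) \<and> \<bar>x\<bar> = c"
  defines "m \<equiv> (case first_two w of None \<Rightarrow> 0
                  | Some (_, b) \<Rightarrow> of_rat c * (if b = 0 then 1 else - 1)) :: real"
  shows "value_Eve V A w = ereal m" "value_Adam V A w = ereal m"
proof -
  have w: "w \<in> words V (alphabet A)" "alphabet A \<noteq> {}"
    using assms(1,3) by (auto simp: refines_late_sign_def)
  have "payoff V \<rho> = m" if \<rho>: "is_play A \<rho>" "word_of \<rho> = w" for \<rho>
  proof (cases "first_two \<rho>")
    case None
    then show ?thesis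
      using payoff_refinement(1)[OF assms(1,2) \<rho>(1)] \<rho>(2) assms(3)
      by (auto simp: m_def word_of_def first_two_map_seq)
  next
    case (Some p)
    then obtain r r' where r: "first_two \<rho> = Some (r, r')" by (cases p) auto
    then have ab: "first_two w = Some (letter r, letter r')"
      using \<rho>(2) by (auto simp: word_of_def first_two_map_seq)
    then have "\<bar>weight r\<bar> = c"
      using c[OF ab] payoff_refinement(3)[OF assms(1,2) \<rho>(1) _ r, of "{0, 1}"] \<rho>(2) assms(3)
      by auto
    then show ?thesis
      using payoff_refinement(1)[OF assms(1,2) \<rho>(1), of "{0, 1}"] \<rho>(2) assms(3) r ab
      by (simp add: m_def)
  qed
  then show "value_Eve V A w = ereal m" "value_Adam V A w = ereal m"
    using value_eqI[OF w, of undefined m] by auto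
qed

lemma value_constant_choice:
  assumes "c \<in> {1, 2}" "V \<in> score_functions" "w \<in> words V {0, 1}"
  shows "value_Eve V (constant_choice c) w =
           ereal (case first_two w of None \<Rightarrow> 0 | Some (_, b) \<Rightarrow> of_rat c * (if b = 0 then 1 else - 1))"
    and "value_Adam V (constant_choice c) w =
           ereal (case first_two w of None \<Rightarrow> 0 | Some (_, b) \<Rightarrow> of_rat c * (if b = 0 then 1 else - 1))"
  using assms
  by (intro value_fixed_first_weight[OF refines_late_sign_constant_choice];
      auto simp: constant_choice_def abs_mult power_abs)+

section \<open>The positive and negative properties of the separating automaton\<close>

lemma threshold_history_deterministic_late_sign:
  assumes "V \<in> score_functions"
  shows "threshold_history_deterministic V late_sign"
  unfolding threshold_history_deterministic_def t_threshold_history_deterministic_def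
    Eve_wins_threshold_letter_game_def Adam_wins_threshold_letter_game_def
proof (intro allI conjI)
  fix t :: real
  have judged: "is_play late_sign \<pi> \<and> word_of \<pi> \<in> words V UNIV \<and>
      value_of V late_sign (word_of \<pi>) = ereal (best (word_of \<pi>))"
    if "is_play late_sign (InfSeq \<rho>)" "\<pi> \<in> judged V \<rho>" for \<rho> \<pi>
  proof -
    have "0 < letter (\<rho> n) \<Longrightarrow> letter (\<rho> n) = 1" for n
      using play_round(1)[OF that(1), of "map \<rho> [0..<n]" "\<rho> n"]
      by (auto simp: snoc_in_prefixes_InfSeq late_sign_def simp del: prefixes_of.simps)
    then have "word_of \<pi> \<in> words V {0, 1}"
      using that(2) by (cases V) (auto simp: word_of_def simp del: upt_Suc)
    then show ?thesis
      using is_play_mono[OF that(1) prefixes_of_judged[OF that(2)]] word_of_judged[OF that(2)] assms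
      by (simp add: value_of_def value_late_sign)
  qed
  show "\<exists>s. \<forall>\<rho>. is_play late_sign (InfSeq \<rho>) \<and> agrees_Eve late_sign s (InfSeq \<rho>) \<longrightarrow>
      (\<forall>\<pi>\<in>judged V \<rho>. ereal t \<le> value_of V late_sign (word_of \<pi>) \<longrightarrow> t \<le> payoff V \<pi>)"
  proof (intro exI allI impI ballI)
    \<comment> \<open>For \<open>t \<le> -1\<close> absolute value 1 keeps every payoff at least -1.
      For larger \<open>t\<close>, a value of at least \<open>t\<close> excludes a negative second
      letter, and absolute value 2 then attains \<open>best\<close>.\<close>
    let ?s = "\<lambda>_ _ _. t \<le> - 1"
    fix \<rho> \<pi>
    assume \<rho>: "is_play late_sign (InfSeq \<rho>) \<and> agrees_Eve late_sign ?s (InfSeq \<rho>)"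
      and \<pi>: "\<pi> \<in> judged V \<rho>" and t: "ereal t \<le> value_of V late_sign (word_of \<pi>)"
    note j = judged[OF conjunct1[OF \<rho>] \<pi>]
    have "agrees_Eve late_sign ?s \<pi>"
      using \<rho> \<pi> by (blast intro: agrees_Eve_mono prefixes_of_judged[THEN subsetD])
    from payoff_late_sign[OF assms _ _ this] j t show "t \<le> payoff V \<pi>"
      by (auto simp: best_word_of split: option.splits if_splits)
  qed
  show "\<exists>s. \<forall>\<rho>. is_play late_sign (InfSeq \<rho>) \<and> agrees_Adam late_sign s (InfSeq \<rho>) \<longrightarrow>
      (\<forall>\<pi>\<in>judged V \<rho>. value_of V late_sign (word_of \<pi>) < ereal t \<longrightarrow> payoff V \<pi> < t)"
    \<comment> \<open>No payoff exceeds the value, so Adam wins with any strategy.\<close>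
    using judged payoff_le_best[OF refines_late_sign_self assms]
    by (metis less_ereal.simps(1) order_le_less_trans)
qed

lemma not_history_deterministic_late_sign:
  assumes V: "V \<in> score_functions"
  shows "\<not> history_deterministic V late_sign"
proof
  assume "history_deterministic V late_sign"
  then obtain s where s: "\<And>\<rho> \<pi>. is_play late_sign (InfSeq \<rho>) \<Longrightarrow>
      agrees_Eve late_sign s (InfSeq \<rho>) \<Longrightarrow> \<pi> \<in> judged V \<rho>
      \<Longrightarrow> value_of V late_sign (word_of \<pi>) \<le> ereal (payoff V \<pi>)"
    unfolding history_deterministic_def Eve_wins_letter_game_def by blast
  \<comment> \<open>After first letter 0, the answer \<open>s [] 0 []\<close> is the same for both
    continuations \<open>b\<close>; \<open>b = 0\<close> demands absolute value 2 and
    \<open>b = 1\<close> demands 1.\<close>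
  have *: "(if b = 0 then 2 else - 1) \<le> (if s [] 0 [] then 1 else 2) * (if b = 0 then 1 else - 1 :: real)"
    if b: "b \<in> {0, 1}" for b :: nat
  proof -
    have "range ((\<lambda>_. 0)(1 := b)) \<subseteq> alphabet late_sign"
      using b by (auto simp: late_sign_def)
    from ex_infinite_play[OF this] obtain \<rho> where
      \<rho>: "\<And>n. letter (\<rho> n) = ((\<lambda>_. 0)(1 := b)) n"
        "is_play late_sign (InfSeq \<rho>)" "agrees_Eve late_sign s (InfSeq \<rho>)" by metis
    \<comment> \<open>For finite words the judged part is the prefix of length two, that is, index 1
      in \<open>judged\<close>; for infinite words it is the whole play.\<close>
    obtain \<pi> where \<pi>: "\<pi> \<in> judged V \<rho>" "first_two \<pi> = Some (\<rho> 0, \<rho> 1)"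
      "word_of \<pi> \<in> words V {0, 1}"
    proof (cases V)
      case (FinVal f)
      have **: "map \<rho> [0..<Suc 1] = [\<rho> 0, \<rho> 1]" by simp
      show thesis
      proof (rule that)
        show "FinSeq (map \<rho> [0..<Suc 1]) \<in> judged V \<rho>"
          unfolding FinVal judged.simps by blast
      qed (use ** b \<rho>(1) FinVal in \<open>auto simp: word_of_def\<close>)
    next
      case (InfVal f)
      show thesis
        by (rule that[of "InfSeq \<rho>"]) (use b \<rho>(1) InfVal in \<open>auto simp: word_of_def\<close>)
    qed
    have "is_play late_sign \<pi>" "agrees_Eve late_sign s \<pi>"
      using \<rho>(2,3) prefixes_of_judged[OF \<pi>(1)] by (blast intro: is_play_mono agrees_Eve_mono)+
    from payoff_late_sign[OF V this(1) \<pi>(3) this(2)] s[OF \<rho>(2,3) \<pi>(1)] \<pi>(2,3) \<rho>(1)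
    show ?thesis
      by (simp add: value_of_def value_late_sign[OF V] best_word_of)
  qed
  from *[of 0] *[of 1] show False by (auto split: if_splits)
qed

lemma threshold_determinizable_by_pruning_late_sign:
  assumes V: "V \<in> score_functions"
  shows "threshold_determinizable_by_pruning V late_sign"
  unfolding threshold_determinizable_by_pruning_def t_threshold_determinizable_by_pruning_def
proof (intro allI exI conjI ballI)
  fix t :: real
  define c :: rat where "c = (if t \<le> - 1 then 1 else 2)"
  then have c: "c \<in> {1, 2}" by simp
  have wf: "wf_automaton (constant_choice c)"
    by (auto simp: wf_automaton_def constant_choice_def)
  show "val_automaton V (constant_choice c)"
    using wf value_constant_choice[OF c V]
    by (auto simp: val_automaton_def constant_choice_def)
  show "deterministic (constant_choice c)"
    by (simp add: deterministic_def constant_choice_def)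
  show "derived_by_pruning late_sign (constant_choice c)"
    using c by (auto simp: derived_by_pruning_def late_sign_def constant_choice_def
        intro: pruned.intros)
  fix w
  assume "w \<in> words V (alphabet late_sign)"
  then have w: "w \<in> words V {0, 1}" by (simp add: late_sign_def)
  \<comment> \<open>The values differ in one way per \<open>c\<close>: 1 against 2 for
    \<open>c = 1\<close>, both above \<open>t \<le> -1\<close>, and -2 against -1 for
    \<open>c = 2\<close>, both below \<open>t > -1\<close>.\<close>
  show "ereal t \<le> value_of V (constant_choice c) w \<longleftrightarrow> ereal t \<le> value_of V late_sign w"
    unfolding value_of_def value_late_sign(1)[OF V w] value_constant_choice(1)[OF c V w]
    by (auto simp: best_def c_def split: option.split)
qed

lemma not_determinizable_by_pruning_late_sign:
  assumes V: "V \<in> score_functions"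
  shows "\<not> determinizable_by_pruning V late_sign"
proof
  assume "determinizable_by_pruning V late_sign"
  then obtain A where A: "wf_automaton A" "deterministic A" "derived_by_pruning late_sign A"
    "equivalent V A late_sign"
    unfolding determinizable_by_pruning_def val_automaton_def by blast
  from refines_late_sign_pruned[OF A(3,1)] have ref: "refines_late_sign A" .
  then obtain x q where x: "trans A 0 0 = Atom (x, q)"
    using A(1,2) unfolding deterministic_def refines_late_sign_def wf_automaton_def by force
  \<comment> \<open>The weight \<open>x\<close> on first letter 0 is fixed by the pruning, yet
    equivalence on words starting with 0, 0 and 0, 1 forces its absolute value to be both 2 and
    1.\<close>
  have *: "(if b = 0 then 2 else - 1) = of_rat \<bar>x\<bar> * (if b = 0 then 1 else - 1 :: real)"
    if b: "b \<in> {0, 1}" for b :: nat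
  proof -
    obtain w where w: "w \<in> words V {0, 1}" "first_two w = Some (0, b)"
    proof (cases V)
      case (FinVal f)
      then show thesis using that[of "FinSeq [0, b]"] b by auto
    next
      case (InfVal f)
      then show thesis using that[of "InfSeq ((\<lambda>_. 0)(1 := b))"] b by auto
    qed
    have "value_Eve V A w = value_Eve V late_sign w"
      using A(4) w(1) ref by (auto simp: equivalent_def value_of_def refines_late_sign_def)
    moreover have "value_Eve V A w = ereal (of_rat \<bar>x\<bar> * (if b = 0 then 1 else - 1))"
      using value_fixed_first_weight(1)[OF ref V w(1), of "\<bar>x\<bar>"] w(2) x by simp
    ultimately show ?thesis
      by (simp add: value_late_sign[OF V w(1)] best_def w(2))
  qed
  from *[of 0] *[of 1] show False by simp
qed

theorem lemma10:
  shows
    "(\<forall>V. \<forall>A :: ('a, 'q) automaton. val_automaton V A \<longrightarrow>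
        history_deterministic V A \<longrightarrow> threshold_history_deterministic V A) \<and>
     (\<forall>K\<in>{range FinVal, range InfVal}. \<exists>V\<in>K. \<exists>B :: (nat, nat) automaton.
        val_automaton V B \<and> real_valued V B \<and>
        threshold_history_deterministic V B \<and> \<not> history_deterministic V B) \<and>
     (\<forall>V. \<forall>A :: ('a, 'q) automaton. val_automaton V A \<longrightarrow>
        determinizable_by_pruning V A \<longrightarrow> threshold_determinizable_by_pruning V A) \<and>
     (\<forall>K\<in>{range FinVal, range InfVal}. \<exists>V\<in>K. \<exists>B :: (nat, nat) automaton.
        val_automaton V B \<and> real_valued V B \<and>
        threshold_determinizable_by_pruning V B \<and> \<not> determinizable_by_pruning V B) \<and>
     (\<forall>K\<in>{range FinVal, range InfVal}. \<exists>V\<in>K. \<exists>B :: (nat, nat) automaton.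
        val_automaton V B \<and> real_valued V B \<and>
        threshold_determinizable_by_pruning V B \<and> \<not> history_deterministic V B)"
proof -
  \<comment> \<open>One automaton witnesses all three separations, for finite and for infinite
    words.\<close>
  have separation: "\<exists>V\<in>K. \<exists>B :: (nat, nat) automaton. val_automaton V B \<and> real_valued V B \<and>
      threshold_history_deterministic V B \<and> \<not> history_deterministic V B \<and>
      threshold_determinizable_by_pruning V B \<and> \<not> determinizable_by_pruning V B"
    if K: "K \<in> {range FinVal, range InfVal}" for K
  proof -
    obtain V where "V \<in> K" "V \<in> score_functions"
      using K by (auto simp: score_functions_def)
    then show ?thesis
      using val_automaton_late_sign real_valued_late_sign
        threshold_history_deterministic_late_sign not_history_deterministic_late_sign
        threshold_determinizable_by_pruning_late_sign not_determinizable_by_pruning_late_sign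
      by blast
  qed
  show ?thesis
    by (intro conjI allI impI ballI history_deterministic_imp_threshold
        determinizable_by_pruning_imp_threshold; use separation in blast)
qed

end
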